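(* Let $r\geq 2$ and $d\geq 1$ be integers. If there is no $\mathfrak{S}_{r+1}$-equivariant continuous map \[\Delta_{r,r+1}^{*(d+1)}*[r+1]\rightarrow S(W_{r+1}^{\oplus(d+1)}),\] then $n(d,r)=(d+1)r$ and $tt(d,r)=r$.
   Context: A coloring of the vertex set of a simplex by $\ell$ colors is a partition into pairwise disjoint color classes $C_1,\ldots,C_\ell$; a face $\sigma$ is rainbow if $|\sigma\cap C_i|\leq1$ for all $i$. $n(d,r)$ is the smallest $n$ such that for every affine map $f:\Delta_{n-1}\to\mathbb{R}^d$ and every coloring of the vertex set of $\Delta_{n-1}$ by $d+1$ colors with each color class of size at least $r$, there exist $r$ pairwise disjoint rainbow faces $\sigma_1,\ldots,\sigma_r$ with $f(\sigma_1)\cap\cdots\cap f(\sigma_r)\neq\emptyset$. $tt(d,r)$ is the smallest $t$ such that for every simplex $\Delta$, every continuous map $f:\Delta\to\mathbb{R}^d$ and every coloring of the vertex set of $\Delta$ by $d+1$ colors with each color class of size at least $t$, there exist $r$ pairwise disjoint rainbow faces of $\Delta$ whose $f$-images have a common point. The chessboard complex $\Delta_{m,n}$ has vertex set $[m]\times[n]$, simplices being vertex sets with pairwise distinct first and pairwise distinct second coordinates; $\mathfrak{S}_{r+1}$ acts on $\Delta_{r,r+1}$ by permuting the second coordinate. $[r+1]$ is the $0$-dimensional complex with $r+1$ vertices, permuted by $\mathfrak{S}_{r+1}$; joins carry the diagonal action. $W_{r+1}=\{t\in\mathbb{R}^{r+1}:\sum t_i=0\}$ with coordinate permutation action, $W_{r+1}^{\oplus(d+1)}$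 the direct sum of $d+1$ copies, $S(\cdot)$ the unit sphere.
   Formalization: n(d,r) is taken as the smallest n for which a coloring by d+1 colors with each class of size at least r exists and the property holds; read literally, the property holds vacuously for n < (d+1)r, which would make n(d,r)=(d+1)r false. *)

theory Defs
  imports "HOL-Homology.Simplices" "HOL-Combinatorics.Permutations" "HOL-Library.Extended_Nat"
begin

text \<open>Throughout, \<open>[n]\<close> is \<open>{..<n}\<close>. An abstract simplicial complex is the set of its
  faces, the empty face included. All complexes used below are finite.\<close>

subsection \<open>Geometric realizations\<close>

text \<open>A point of the realization is given by its barycentric coordinates. For a finite complex the
  topology of pointwise convergence is the usual one. Infinite supports are excluded because the
  sum over them is 0.\<close>

definition realization :: "'v set set \<Rightarrow> ('v \<Rightarrow> real) set" where
  "realization K = {x. (\<forall>v. 0 \<le> x v) \<and> {v. x v \<noteq> 0} \<in> K \<and> (\<Sum>v | x v \<noteq> 0. x v) = 1}"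

definition realization_top :: "'v set set \<Rightarrow> ('v \<Rightarrow> real) topology" where
  "realization_top K = subtopology (powertop_real UNIV) (realization K)"

text \<open>The simplex with vertex set \<open>V\<close> is \<open>realization (Pow V)\<close>; in particular
  \<open>\<Delta>\<^bsub>n-1\<^esub>\<close> is \<open>realization (Pow {..<n})\<close>, and its face spanned by \<open>\<sigma> \<subseteq> {..<n}\<close> is
  \<open>realization (Pow \<sigma>)\<close>. It agrees with the simplex of the library:\<close>

lemma realization_Pow_eq_standard_simplex:
  "realization (Pow {..<Suc p}) = standard_simplex p"
proof (intro Set.set_eqI iffI)
  fix x :: "nat \<Rightarrow> real"
  assume x: "x \<in> realization (Pow {..<Suc p})"
  then have sub: "{v. x v \<noteq> 0} \<subseteq> {..p}" and nn: "\<And>v. 0 \<le> x v"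
    and s: "(\<Sum>v | x v \<noteq> 0. x v) = 1"
    by (auto simp: realization_def)
  have s': "sum x {..p} = 1"
    using sum.mono_neutral_left[OF finite_atMost sub, of x] s by auto
  have "x i \<le> 1" for i
  proof (cases "i \<le> p")
    case True
    then show ?thesis using member_le_sum[of i "{..p}" x] nn s' by auto
  next
    case False
    then have "x i = 0" using sub by auto
    then show ?thesis by simp
  qed
  moreover have "x i = 0" if "i > p" for i using sub that by fastforce
  ultimately show "x \<in> standard_simplex p"
    using nn s' by (auto simp: standard_simplex_def)
next
  fix x :: "nat \<Rightarrow> real"
  assume x: "x \<in> standard_simplex p"
  then have nn: "\<And>v. 0 \<le> x v" and z: "\<And>i. i > p \<Longrightarrow> x i = 0" and s: "sum x {..p} = 1"
    by (auto simp: standard_simplex_def)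
  have sub: "{v. x v \<noteq> 0} \<subseteq> {..p}" using z by (auto simp: not_less[symmetric])
  have "(\<Sum>v | x v \<noteq> 0. x v) = 1"
    using sum.mono_neutral_left[OF finite_atMost sub, of x] s by auto
  then show "x \<in> realization (Pow {..<Suc p})"
    using nn sub by (auto simp: realization_def lessThan_Suc_atMost)
qed

subsection \<open>Colorings and the numbers \<open>n(d,r)\<close> and \<open>tt(d,r)\<close>\<close>

definition coloring :: "nat \<Rightarrow> 'v set \<Rightarrow> (nat \<Rightarrow> 'v set) \<Rightarrow> bool" where
  "coloring l V C \<longleftrightarrow> disjoint_family_on C {..<l} \<and> (\<Union>i<l. C i) = V"

definition rainbow :: "nat \<Rightarrow> (nat \<Rightarrow> 'v set) \<Rightarrow> 'v set \<Rightarrow> bool" where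
  "rainbow l C \<sigma> \<longleftrightarrow> (\<forall>i<l. card (\<sigma> \<inter> C i) \<le> 1)"

definition affine_simplex_map :: "nat \<Rightarrow> nat \<Rightarrow> ((nat \<Rightarrow> real) \<Rightarrow> (nat \<Rightarrow> real)) \<Rightarrow> bool" where
  "affine_simplex_map n d f \<longleftrightarrow>
     f \<in> realization (Pow {..<n}) \<rightarrow> topspace (Euclidean_space d) \<and>
     (\<forall>x \<in> realization (Pow {..<n}). \<forall>y \<in> realization (Pow {..<n}). \<forall>u \<in> {0..1}.
        f (\<lambda>i. (1 - u) * x i + u * y i) = (\<lambda>j. (1 - u) * f x j + u * f y j))"

definition has_rainbow_intersection ::
  "nat \<Rightarrow> nat \<Rightarrow> nat \<Rightarrow> (nat \<Rightarrow> nat set) \<Rightarrow> ((nat \<Rightarrow> real) \<Rightarrow> (nat \<Rightarrow> real)) \<Rightarrow> bool" where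
  "has_rainbow_intersection n l r C f \<longleftrightarrow>
     (\<exists>\<sigma>. (\<forall>j<r. \<sigma> j \<subseteq> {..<n} \<and> rainbow l C (\<sigma> j)) \<and>
          disjoint_family_on \<sigma> {..<r} \<and>
          (\<Inter>j<r. f ` realization (Pow (\<sigma> j))) \<noteq> {})"

text \<open>Both numbers are infima in \<open>enat\<close>, so they are \<open>\<infinity>\<close> if no number has the required property.

  If \<open>n < (d+1)r\<close>, then \<open>{..<n}\<close> has no coloring with \<open>d+1\<close> classes of size at least \<open>r\<close>, and the
  property defining \<open>n(d,r)\<close> would hold vacuously. As usual, the minimum is taken over those \<open>n\<close> for
  which such colorings exist.\<close>

definition n_number :: "nat \<Rightarrow> nat \<Rightarrow> enat" where
  "n_number d r = Inf (enat ` {n.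
     (\<exists>C. coloring (d+1) {..<n} C \<and> (\<forall>i<d+1. r \<le> card (C i))) \<and>
     (\<forall>f C. affine_simplex_map n d f \<and> coloring (d+1) {..<n} C \<and> (\<forall>i<d+1. r \<le> card (C i))
        \<longrightarrow> has_rainbow_intersection n (d+1) r C f)})"

definition tt_number :: "nat \<Rightarrow> nat \<Rightarrow> enat" where
  "tt_number d r = Inf (enat ` {t.
     \<forall>n\<ge>1. \<forall>f C. continuous_map (realization_top (Pow {..<n})) (Euclidean_space d) f \<and>
        coloring (d+1) {..<n} C \<and> (\<forall>i<d+1. t \<le> card (C i))
        \<longrightarrow> has_rainbow_intersection n (d+1) r C f})"

subsection \<open>Chessboard complexes and joins\<close>

definition chessboard :: "nat \<Rightarrow> nat \<Rightarrow> (nat \<times> nat) set set" where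
  "chessboard m n = {\<sigma>. \<sigma> \<subseteq> {..<m} \<times> {..<n} \<and> inj_on fst \<sigma> \<and> inj_on snd \<sigma>}"

definition discrete_complex :: "nat \<Rightarrow> nat set set" where
  "discrete_complex n = insert {} ((\<lambda>v. {v}) ` {..<n})"

definition complex_join :: "'a set set \<Rightarrow> 'b set set \<Rightarrow> ('a + 'b) set set" where
  "complex_join K L = {Inl ` \<sigma> \<union> Inr ` \<tau> |\<sigma> \<tau>. \<sigma> \<in> K \<and> \<tau> \<in> L}"

text \<open>The \<open>k\<close>-fold join \<open>K\<^sup>*\<^sup>k\<close>; the vertex \<open>v\<close> of the \<open>i\<close>-th copy of \<open>K\<close> is \<open>(i, v)\<close>.\<close>

definition complex_join_power :: "'a set set \<Rightarrow> nat \<Rightarrow> (nat \<times> 'a) set set" where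
  "complex_join_power K k = {Sigma {..<k} \<tau> |\<tau>. \<forall>i<k. \<tau> i \<in> K}"

definition domain_complex :: "nat \<Rightarrow> nat \<Rightarrow> ((nat \<times> nat \<times> nat) + nat) set set" where
  "domain_complex d r =
     complex_join (complex_join_power (chessboard r (r+1)) (d+1)) (discrete_complex (r+1))"

subsection \<open>The representation \<open>W\<^bsub>n\<^esub>\<^sup>\<oplus>\<^sup>k\<close> and its unit sphere\<close>

definition W_rep :: "nat \<Rightarrow> (nat \<Rightarrow> real) set" where
  "W_rep n = {t \<in> topspace (Euclidean_space n). (\<Sum>i<n. t i) = 0}"

text \<open>The entry \<open>w (i, j)\<close> is the \<open>j\<close>-th coordinate of the \<open>i\<close>-th summand.\<close>

definition W_rep_power :: "nat \<Rightarrow> nat \<Rightarrow> (nat \<times> nat \<Rightarrow> real) set" where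
  "W_rep_power n k =
     {w. (\<forall>i<k. (\<lambda>j. w (i, j)) \<in> W_rep n) \<and> (\<forall>i\<ge>k. \<forall>j. w (i, j) = 0)}"

definition W_sphere_top :: "nat \<Rightarrow> nat \<Rightarrow> (nat \<times> nat \<Rightarrow> real) topology" where
  "W_sphere_top n k = subtopology (powertop_real UNIV)
     {w \<in> W_rep_power n k. (\<Sum>i<k. \<Sum>j<n. (w (i, j))\<^sup>2) = 1}"

subsection \<open>The actions of the symmetric group\<close>

text \<open>A bijection \<open>g\<close> of the index set acts (from the left) on families of reals by moving the
  entry at \<open>v\<close> to \<open>g v\<close>. On barycentric coordinates this is the affine extension of the vertex
  map \<open>g\<close>.\<close>

definition perm_action :: "('v \<Rightarrow> 'v) \<Rightarrow> ('v \<Rightarrow> real) \<Rightarrow> ('v \<Rightarrow> real)" where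
  "perm_action g x = x \<circ> inv_into UNIV g"

definition domain_vertex_map ::
  "(nat \<Rightarrow> nat) \<Rightarrow> (nat \<times> nat \<times> nat) + nat \<Rightarrow> (nat \<times> nat \<times> nat) + nat" where
  "domain_vertex_map \<pi> = map_sum (map_prod id (map_prod id \<pi>)) \<pi>"

definition equivariant_map ::
  "nat \<Rightarrow> nat \<Rightarrow> ((((nat \<times> nat \<times> nat) + nat) \<Rightarrow> real) \<Rightarrow> (nat \<times> nat \<Rightarrow> real)) \<Rightarrow> bool" where
  "equivariant_map d r F \<longleftrightarrow>
     (\<forall>\<pi>. \<pi> permutes {..<r+1} \<longrightarrow>
        (\<forall>x \<in> realization (domain_complex d r).
           F (perm_action (domain_vertex_map \<pi>) x) = perm_action (map_prod id \<pi>) (F x)))"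

end

theory Submission
  imports Defs
begin

text \<open>For the upper bounds, add one extra vertex as an additional color class and choose \<open>r\<close>
  vertices of each given color. A point of \<open>\<Delta>\<^bsub>r,r+1\<^esub>\<^sup>*\<^sup>(\<^sup>d\<^sup>+\<^sup>1\<^sup>) * [r+1]\<close> is a convex
  combination, with weights \<open>\<lambda>\<^sub>j\<close>, of points \<open>x\<^sub>j\<close> in \<open>r+1\<close> disjoint rainbow faces. Sending it to
  the vectors \<open>\<lambda>\<^sub>j (f(x\<^sub>j), 1)\<close> minus their average is equivariant into \<open>W\<^bsub>r+1\<^esub>\<^sup>\<oplus>\<^sup>(\<^sup>d\<^sup>+\<^sup>1\<^sup>)\<close>, so
  by hypothesis it has a zero, where all \<open>\<lambda>\<^sub>j\<close> are equal and all \<open>f(x\<^sub>j)\<close> coincide. At most one of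
  the faces contains the extra vertex; drop it (or any one face).

  The lower bound for \<open>n(d,r)\<close> is a count of vertices. For \<open>tt(d,r)\<close>, mapping \<open>d+1\<close> color classes of
  size \<open>r-1\<close> to the vertices of a simplex leaves too few vertices of each color.\<close>

section \<open>Realizations of simplices and continuity of maps defined on complexes\<close>

lemma realization_Pow_iff:
  assumes "finite V"
  shows "x \<in> realization (Pow V) \<longleftrightarrow>
    (\<forall>v. 0 \<le> x v) \<and> (\<forall>v. v \<notin> V \<longrightarrow> x v = 0) \<and> sum x V = 1"
proof -
  have "sum x {v. x v \<noteq> 0} = sum x V" if "{v. x v \<noteq> 0} \<subseteq> V"
    using assms that by (intro sum.mono_neutral_left) auto
  moreover have "{v. x v \<noteq> 0} \<subseteq> V \<longleftrightarrow> (\<forall>v. v \<notin> V \<longrightarrow> x v = 0)" by blast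
  ultimately show ?thesis unfolding realization_def by auto
qed

lemma realization_Pow_mono:
  "S \<subseteq> T \<Longrightarrow> x \<in> realization (Pow S) \<Longrightarrow> x \<in> realization (Pow T)"
  by (auto simp: realization_def)

text \<open>Both targets, \<open>Euclidean_space d\<close> and the sphere in
  \<open>W_sphere_top\<close>, are subspaces of a product of real lines, so one coordinatewise
  criterion serves both.\<close>

lemma continuous_map_realization_iff:
  fixes f :: "('v \<Rightarrow> real) \<Rightarrow> ('w \<Rightarrow> real)"
  shows "continuous_map (realization_top K) (subtopology (powertop_real UNIV) S) f \<longleftrightarrow>
    (\<forall>w. continuous_on (realization K) (\<lambda>x. f x w)) \<and> f ` realization K \<subseteq> S"
proof -
  have "continuous_map (top_of_set (realization K)) euclidean f \<longleftrightarrow>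
      (\<forall>w. continuous_on (realization K) (\<lambda>x. f x w))"
    by (auto intro: continuous_on_product_then_coordinatewise
        continuous_on_coordinatewise_then_product)
  then show ?thesis
    by (simp add: realization_top_def euclidean_product_topology continuous_map_in_subtopology
        image_subset_iff Pi_iff)
qed

lemma continuous_map_realization_Euclidean_iff:
  "continuous_map (realization_top K) (Euclidean_space d) f \<longleftrightarrow>
    (\<forall>i. continuous_on (realization K) (\<lambda>x. f x i)) \<and>
    (\<forall>x\<in>realization K. \<forall>i\<ge>d. f x i = 0)"
  by (auto simp: Euclidean_space_def continuous_map_realization_iff)

lemma continuous_on_coordinate [continuous_intros]:
  "continuous_on S (\<lambda>x :: 'a \<Rightarrow> real. x v)"
  using continuous_on_subset[OF continuous_on_product_coordinates subset_UNIV] .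

text \<open>At zeros of \<open>l\<close> the product is squeezed by
  \<open>B * \<bar>l x\<bar>\<close>, so \<open>h\<close> may jump there. This is what happens to
  the image of a face point as the mass of its face tends to 0.\<close>

lemma continuous_on_mult_bounded:
  fixes l h :: "'a::t2_space \<Rightarrow> real"
  assumes l: "continuous_on S l"
    and h: "continuous_on {x \<in> S. l x \<noteq> 0} h"
    and B: "\<And>x. x \<in> S \<Longrightarrow> \<bar>h x\<bar> \<le> B"
  shows "continuous_on S (\<lambda>x. l x * h x)"
  unfolding continuous_on_def
proof
  fix x assume x: "x \<in> S"
  have lx: "(l \<longlongrightarrow> l x) (at x within S)"
    using l x by (simp add: continuous_on_def)
  show "((\<lambda>x. l x * h x) \<longlongrightarrow> l x * h x) (at x within S)"
  proof (cases "l x = 0")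
    case True
    have "((\<lambda>x. B * \<bar>l x\<bar>) \<longlongrightarrow> B * \<bar>l x\<bar>) (at x within S)"
      by (intro tendsto_intros lx)
    then have *: "((\<lambda>x. B * \<bar>l x\<bar>) \<longlongrightarrow> 0) (at x within S)"
      using True by simp
    have "((\<lambda>x. l x * h x) \<longlongrightarrow> 0) (at x within S)"
    proof (rule Lim_null_comparison[OF _ *])
      have "norm (l y * h y) \<le> B * \<bar>l y\<bar>" if "y \<in> S" for y
        using mult_left_mono[OF B[OF that], of "\<bar>l y\<bar>"] by (simp add: abs_mult mult.commute)
      then show "\<forall>\<^sub>F y in at x within S. norm (l y * h y) \<le> B * \<bar>l y\<bar>"
        by (simp add: eventually_at_filter)
    qed
    then show ?thesis using True by simp
  next
    case False
    \<comment> \<open>The set where \<open>l\<close> is nonzero is relatively open in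
      \<open>S\<close>, so limits at \<open>x\<close> within it and within \<open>S\<close>
      agree.\<close>
    have "openin (top_of_set S) (S \<inter> l -` (- {0}))"
      using l by (intro continuous_openin_preimage_gen) auto
    then obtain U where U: "open U" "S \<inter> l -` (- {0}) = S \<inter> U"
      by (auto simp: openin_open)
    have "{x \<in> S. l x \<noteq> 0} = S \<inter> U" using U(2) by auto
    moreover from this have "x \<in> U" using x False by auto
    ultimately have "at x within S = at x within {x \<in> S. l x \<noteq> 0}"
      using U(1) by (intro at_within_nhd[of x U]) auto
    moreover have "(h \<longlongrightarrow> h x) (at x within {x \<in> S. l x \<noteq> 0})"
      using h x False by (auto simp: continuous_on_def)
    ultimately show ?thesis using tendsto_mult[OF lx] by simp
  qed
qed

section \<open>Affine maps are determined by the vertices, hence continuous\<close>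

text \<open>Induction on the number of vertices used: split off vertex \<open>m\<close> with weight
  \<open>x m\<close> and rescale the rest to total weight 1, unless \<open>x m = 1\<close>. The
  bound \<open>m\<close> is separate from \<open>n\<close> so that affinity of \<open>f\<close>
  stays available on the whole simplex. The formula yields continuity, which
  \<open>affine_simplex_map\<close> does not state.\<close>

lemma affine_simplex_map_eq_sum:
  assumes f: "affine_simplex_map n d f" and "m \<le> n" and "x \<in> realization (Pow {..<m})"
  shows "f x j = (\<Sum>v<m. x v * f (\<lambda>i. of_bool (i = v)) j)"
  using assms(2,3)
proof (induction m arbitrary: x)
  case 0
  then show ?case by (simp add: realization_Pow_iff del: Pow_empty)
next
  case (Suc m)
  let ?e = "\<lambda>i. of_bool (i = m) :: real"
  have x: "\<And>v. 0 \<le> x v" "\<And>v. v > m \<Longrightarrow> x v = 0" "sum x {..<m} + x m = 1"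
    using Suc.prems(2) by (auto simp: realization_Pow_iff)
  show ?case
  proof (cases "x m = 1")
    case True
    then have "\<forall>v<m. x v = 0"
      using x sum_nonneg_eq_0_iff[of "{..<m}" x] by auto
    moreover from this True x(2) have "x = ?e"
      by (auto simp: fun_eq_iff) (metis linorder_neqE_nat)
    ultimately show ?thesis by simp
  next
    case False
    have "sum x {..<m} \<ge> 0" using x by (intro sum_nonneg) auto
    with False x(3) have lt: "x m < 1" by linarith
    define y where "y = (\<lambda>v. if v < m then x v / (1 - x m) else 0)"
    have "(\<Sum>v<m. y v) = (\<Sum>v<m. x v) / (1 - x m)"
      by (simp add: y_def sum_divide_distrib)
    also have "\<dots> = 1" using x(3) lt by (simp add: field_simps)
    finally have y: "y \<in> realization (Pow {..<m})"
      using x lt by (auto simp: realization_Pow_iff y_def)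
    have "y \<in> realization (Pow {..<n})"
      by (rule realization_Pow_mono[OF _ y]) (use Suc.prems(1) in auto)
    moreover have "?e \<in> realization (Pow {..<n})"
      using Suc.prems(1) by (auto simp: realization_Pow_iff)
    moreover have "x m \<in> {0..1}" using x lt by auto
    moreover have "f (\<lambda>i. (1 - u) * a i + u * b i) = (\<lambda>j. (1 - u) * f a j + u * f b j)"
      if "a \<in> realization (Pow {..<n})" "b \<in> realization (Pow {..<n})" "u \<in> {0..1}" for a b u
      using f that unfolding affine_simplex_map_def by simp
    ultimately have "f (\<lambda>i. (1 - x m) * y i + x m * ?e i) = (\<lambda>j. (1 - x m) * f y j + x m * f ?e j)"
      by presburger
    moreover have "(\<lambda>i. (1 - x m) * y i + x m * ?e i) = x"
      using x(2) lt by (auto simp: fun_eq_iff y_def not_less)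
    ultimately have "f x j = (1 - x m) * (\<Sum>v<m. y v * f (\<lambda>i. of_bool (i = v)) j) + x m * f ?e j"
      using Suc.IH[OF _ y] Suc.prems(1) by simp
    also have "(1 - x m) * (\<Sum>v<m. y v * f (\<lambda>i. of_bool (i = v)) j)
        = (\<Sum>v<m. x v * f (\<lambda>i. of_bool (i = v)) j)"
      using lt by (simp add: sum_distrib_left y_def)
    finally show ?thesis by simp
  qed
qed

lemma affine_simplex_map_continuous:
  assumes "affine_simplex_map n d f"
  shows "continuous_map (realization_top (Pow {..<n})) (Euclidean_space d) f"
  unfolding continuous_map_realization_Euclidean_iff
proof (intro conjI allI ballI impI)
  fix i
  have "continuous_on (realization (Pow {..<n}))
      (\<lambda>x. \<Sum>v<n. x v * f (\<lambda>i. of_bool (i = v)) i)"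
    by (intro continuous_intros)
  then show "continuous_on (realization (Pow {..<n})) (\<lambda>x. f x i)"
    using affine_simplex_map_eq_sum[OF assms le_refl] by (simp cong: continuous_on_cong)
next
  fix x i assume "x \<in> realization (Pow {..<n})" "i \<ge> d"
  then show "f x i = 0"
    using assms by (auto simp: affine_simplex_map_def Pi_iff topspace_Euclidean_space)
qed

section \<open>Colorings by equal blocks, and the lower bounds\<close>

text \<open>The color of \<open>v\<close> is \<open>v div m\<close>. With \<open>m = r\<close> this
  shows that admissible colorings exist on \<open>(d+1) * r\<close> vertices; with
  \<open>m = r - 1\<close> it is the coloring of the counterexample for
  \<open>tt_number\<close>.\<close>

lemma coloring_blocks:
  assumes "m > 0"
  shows "coloring l {..<l * m} (\<lambda>i. {i * m..<i * m + m})"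
proof -
  have block: "v \<in> {i * m..<i * m + m} \<longleftrightarrow> v div m = i" for v i
  proof
    assume "v \<in> {i * m..<i * m + m}"
    then show "v div m = i" by (intro div_nat_eqI) (auto simp: mult.commute)
  next
    assume "v div m = i"
    then show "v \<in> {i * m..<i * m + m}"
      using assms div_times_less_eq_dividend[of v m] dividend_less_div_times[of m v] by force
  qed
  have "disjoint_family_on (\<lambda>i. {i * m..<i * m + m}) {..<l}"
    unfolding disjoint_family_on_def disjoint_iff by (simp only: block) simp
  moreover have "v \<in> (\<Union>i<l. {i * m..<i * m + m}) \<longleftrightarrow> v \<in> {..<l * m}" for v
  proof -
    have "v \<in> (\<Union>i<l. {i * m..<i * m + m}) \<longleftrightarrow> v div m < l"
      unfolding UN_iff block by simp
    then show ?thesis using assms by (simp add: div_less_iff_less_mult)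
  qed
  ultimately show ?thesis unfolding coloring_def by blast
qed

lemma coloring_card_le:
  assumes "coloring l {..<n} C" and "\<forall>i<l. m \<le> card (C i)"
  shows "l * m \<le> n"
proof -
  have C: "(\<Union>i<l. C i) = {..<n}" "disjoint_family_on C {..<l}"
    using assms(1) by (auto simp: coloring_def)
  have "finite (C i)" if "i < l" for i
    using finite_subset[of "C i" "{..<n}"] C(1) that by blast
  with C have "n = (\<Sum>i<l. card (C i))"
    using card_UN_disjoint'[of C "{..<l}"] by auto
  also have "\<dots> \<ge> (\<Sum>i<l. m)"
    using assms(2) by (intro sum_mono) auto
  finally show ?thesis by simp
qed

text \<open>All vertices of one color go to the same vertex of a simplex in \<open>\<real>\<^sup>d\<close>. The color weights of
  a common image point are then the same in all faces, so some color occurs in every face.\<close>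

lemma no_rainbow_intersection:
  fixes m d r :: nat
  assumes "m > 0" and "m < r"
  obtains f where
    "continuous_map (realization_top (Pow {..<(d+1) * m})) (Euclidean_space d) f"
    "\<not> has_rainbow_intersection ((d+1) * m) (d+1) r (\<lambda>i. {i * m..<i * m + m}) f"
proof
  let ?n = "(d+1) * m" and ?C = "\<lambda>i. {i * m..<i * m + m}"
  \<comment> \<open>Vertices of color \<open>i < d\<close> go to the \<open>i\<close>-th unit vector
    and those of color \<open>d\<close> to the origin, so coordinate \<open>i\<close> of the image
    is the total weight of color \<open>i\<close>.\<close>
  define f where "f = (\<lambda>x :: nat \<Rightarrow> real. \<lambda>i. if i < d then sum x (?C i) else 0)"
  show "continuous_map (realization_top (Pow {..<?n})) (Euclidean_space d) f"
    unfolding continuous_map_realization_Euclidean_iff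
  proof (intro conjI allI ballI impI)
    fix i show "continuous_on (realization (Pow {..<?n})) (\<lambda>x. f x i)"
      unfolding f_def by (cases "i < d") (simp_all add: continuous_on_sum continuous_on_coordinate)
  qed (simp add: f_def)
  show "\<not> has_rainbow_intersection ?n (d+1) r ?C f"
  proof
    assume "has_rainbow_intersection ?n (d+1) r ?C f"
    then obtain \<sigma> where \<sigma>': "\<forall>j<r. \<sigma> j \<subseteq> {..<?n} \<and> rainbow (d+1) ?C (\<sigma> j)"
      "disjoint_family_on \<sigma> {..<r}" "(\<Inter>j<r. f ` realization (Pow (\<sigma> j))) \<noteq> {}"
      unfolding has_rainbow_intersection_def by (elim exE conjE)
    then have \<sigma>: "\<And>j. j < r \<Longrightarrow> \<sigma> j \<subseteq> {..<?n}" "disjoint_family_on \<sigma> {..<r}"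
      by simp_all
    obtain p where "p \<in> (\<Inter>j<r. f ` realization (Pow (\<sigma> j)))"
      using \<sigma>'(3) unfolding ex_in_conv[symmetric] by (elim exE)
    then have "\<forall>j\<in>{..<r}. \<exists>y. y \<in> realization (Pow (\<sigma> j)) \<and> f y = p"
      by (simp add: image_iff) metis
    then obtain x where x: "\<And>j. j < r \<Longrightarrow> x j \<in> realization (Pow (\<sigma> j))"
      and fx: "\<And>j. j < r \<Longrightarrow> f (x j) = p"
      unfolding bchoice_iff by auto
    have split: "(\<Sum>i<d+1. sum (x j) (?C i)) = 1" if "j < r" for j
    proof -
      have "x j \<in> realization (Pow {..<?n})"
        using realization_Pow_mono[OF \<sigma>(1)[OF that] x[OF that]] .
      then have "1 = sum (x j) {..<?n}" by (simp add: realization_Pow_iff)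
      also have "\<dots> = (\<Sum>i<d+1. sum (x j) (?C i))"
        using coloring_blocks[OF assms(1), of "d+1"] sum.UNION_disjoint[of "{..<d+1}" ?C "x j"]
        by (auto simp: coloring_def disjoint_family_on_def)
      finally show ?thesis by simp
    qed
    have "sum (x j) (?C i) = p i" if "j < r" "i < d" for i j
      using fx[OF that(1)] that(2) by (auto simp: f_def)
    \<comment> \<open>Color \<open>d\<close> has no coordinate of its own; its weight is what the
      others leave of the total 1.\<close>
    then have same: "sum (x j) (?C i) = (if i < d then p i else 1 - sum p {..<d})"
      if "j < r" "i < d + 1" for i j
      using split[OF that(1)] that by (auto simp: less_Suc_eq)
    obtain i where i: "i < d + 1" "sum (x 0) (?C i) \<noteq> 0"
    proof -
      have "(\<Sum>i<d+1. sum (x 0) (?C i)) \<noteq> 0" using split[of 0] assms by simp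
      then show ?thesis using that by (metis (no_types, lifting) lessThan_iff sum.neutral)
    qed
    have "\<exists>v. v \<in> \<sigma> j \<inter> ?C i" if "j < r" for j
    proof -
      have "sum (x j) (?C i) \<noteq> 0" using i same[of 0 i] same[of j i] that assms by auto
      then obtain v where "v \<in> ?C i" "x j v \<noteq> 0" by (meson sum.neutral)
      then show ?thesis using x[OF that] by (auto simp: realization_def)
    qed
    then obtain v where v: "\<And>j. j < r \<Longrightarrow> v j \<in> \<sigma> j \<inter> ?C i" by metis
    \<comment> \<open>Disjoint faces give \<open>r\<close> distinct vertices of color
      \<open>i\<close>, but only \<open>m < r\<close> exist.\<close>
    have "inj_on v {..<r}"
    proof (rule inj_onI, rule ccontr)
      fix j k assume jk: "j \<in> {..<r}" "k \<in> {..<r}" "v j = v k" "j \<noteq> k"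
      then have "\<sigma> j \<inter> \<sigma> k = {}" using disjoint_family_onD[OF \<sigma>(2)] by blast
      then show False using v[of j] v[of k] jk by auto
    qed
    moreover have "v ` {..<r} \<subseteq> ?C i" using v by blast
    ultimately have "card {..<r} \<le> card (?C i)" by (intro card_inj_on_le) auto
    then show False using assms by simp
  qed
qed

section \<open>Points of the domain complex as weighted families of faces\<close>

text \<open>\<open>None\<close> stands for the extra vertex and \<open>Some (i, a)\<close> for the
  \<open>a\<close>-th chosen vertex of color \<open>i\<close>. Weight on \<open>slot w j\<close>
  means that vertex \<open>w\<close> is used by face \<open>j\<close>, so the symmetric group
  permutes the faces.\<close>

definition slot :: "(nat \<times> nat) option \<Rightarrow> nat \<Rightarrow> (nat \<times> nat \<times> nat) + nat" where
  "slot w j = (case w of None \<Rightarrow> Inr j | Some (i, a) \<Rightarrow> Inl (i, a, j))"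

definition ext_vertices :: "nat \<Rightarrow> nat \<Rightarrow> (nat \<times> nat) option set" where
  "ext_vertices d r = insert None (Some ` ({..<d+1} \<times> {..<r}))"

text \<open>The weight \<lambda>\<open>j\<close> of face \<open>j\<close> in the convex
  combination.\<close>

definition face_mass :: "nat \<Rightarrow> nat \<Rightarrow> ((nat \<times> nat \<times> nat) + nat \<Rightarrow> real) \<Rightarrow> nat \<Rightarrow> real" where
  "face_mass d r x j = (\<Sum>w\<in>ext_vertices d r. x (slot w j))"

lemma finite_ext_vertices [simp]: "finite (ext_vertices d r)"
  by (simp add: ext_vertices_def)

lemma slot_eq_iff [simp]: "slot w j = slot w' j' \<longleftrightarrow> w = w' \<and> j = j'"
  by (auto simp: slot_def split: option.splits)

lemma domain_vertex_map_slot [simp]: "domain_vertex_map \<pi> (slot w j) = slot w (\<pi> j)"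
  by (auto simp: slot_def domain_vertex_map_def split: option.splits)

lemma inj_domain_vertex_map: "inj \<pi> \<Longrightarrow> inj (domain_vertex_map \<pi>)"
  unfolding domain_vertex_map_def by (intro sum.inj_map prod.inj_map) auto

lemma perm_action_apply: "inj g \<Longrightarrow> perm_action g x (g v) = x v"
  by (simp add: perm_action_def)

lemma perm_action_slot:
  "inj \<pi> \<Longrightarrow> perm_action (domain_vertex_map \<pi>) x (slot w (\<pi> j)) = x (slot w j)"
  using perm_action_apply[OF inj_domain_vertex_map, of \<pi> x "slot w j"] by simp

context
  fixes d r :: nat and x :: "(nat \<times> nat \<times> nat) + nat \<Rightarrow> real"
  assumes x: "x \<in> realization (domain_complex d r)"
begin

lemma domain_realization_nonneg: "0 \<le> x v"
  using x by (simp add: realization_def)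

lemma domain_support:
  obtains \<tau> \<rho> where "{v. x v \<noteq> 0} = Inl ` Sigma {..<d+1} \<tau> \<union> Inr ` \<rho>"
    "\<And>i. i < d+1 \<Longrightarrow> \<tau> i \<in> chessboard r (r+1)" "\<rho> \<in> discrete_complex (r+1)"
proof -
  have "{v. x v \<noteq> 0} \<in> domain_complex d r"
    using x by (simp add: realization_def)
  then show ?thesis
    unfolding domain_complex_def complex_join_def complex_join_power_def using that by blast
qed

text \<open>Disjointness of the faces: in a chessboard simplex the first coordinate determines the
  second, and a simplex of \<open>[r+1]\<close> has at most one vertex.\<close>

lemma domain_slot_unique:
  assumes "x (slot w j) \<noteq> 0" "x (slot w k) \<noteq> 0"
  shows "j = k"
proof -
  obtain \<tau> \<rho> where S: "{v. x v \<noteq> 0} = Inl ` Sigma {..<d+1} \<tau> \<union> Inr ` \<rho>"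
    "\<And>i. i < d+1 \<Longrightarrow> \<tau> i \<in> chessboard r (r+1)" "\<rho> \<in> discrete_complex (r+1)"
    by (rule domain_support) (rule that)
  have mem: "slot w j \<in> Inl ` Sigma {..<d+1} \<tau> \<union> Inr ` \<rho>" "slot w k \<in> Inl ` Sigma {..<d+1} \<tau> \<union> Inr ` \<rho>"
    using S(1) assms by blast+
  show ?thesis
  proof (cases w)
    case None
    then show ?thesis using mem S(3) by (auto simp: slot_def discrete_complex_def)
  next
    case (Some p)
    then obtain i a where w: "w = Some (i, a)" by (cases p) auto
    then have "i < d+1" "(a, j) \<in> \<tau> i" "(a, k) \<in> \<tau> i"
      using mem by (auto simp: slot_def)
    then show ?thesis
      using S(2)[of i] inj_onD[of fst "\<tau> i" "(a, j)" "(a, k)"] by (simp add: chessboard_def)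
  qed
qed

text \<open>The faces are rainbow because in a chessboard simplex the second coordinate determines
  the first.\<close>

lemma domain_slot_rainbow:
  assumes "x (slot (Some (i, a)) j) \<noteq> 0" "x (slot (Some (i, b)) j) \<noteq> 0"
  shows "a = b"
proof -
  obtain \<tau> \<rho> where S: "{v. x v \<noteq> 0} = Inl ` Sigma {..<d+1} \<tau> \<union> Inr ` \<rho>"
    "\<And>i. i < d+1 \<Longrightarrow> \<tau> i \<in> chessboard r (r+1)" "\<rho> \<in> discrete_complex (r+1)"
    by (rule domain_support) (rule that)
  have "Inl (i, a, j) \<in> Inl ` Sigma {..<d+1} \<tau> \<union> Inr ` \<rho>"
    "Inl (i, b, j) \<in> Inl ` Sigma {..<d+1} \<tau> \<union> Inr ` \<rho>"
    unfolding S(1)[symmetric] using assms by (auto simp: slot_def)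
  then have "i < d+1" "(a, j) \<in> \<tau> i" "(b, j) \<in> \<tau> i" by auto
  then show ?thesis
    using S(2)[of i] inj_onD[of snd "\<tau> i" "(a, j)" "(b, j)"] by (simp add: chessboard_def)
qed

text \<open>Every vertex in the support of \<open>x\<close> is a slot of exactly one pair
  \<open>(j, w)\<close>, so summing face by face regroups the barycentric coordinates.\<close>

lemma sum_face_mass: "(\<Sum>j<r+1. face_mass d r x j) = 1"
proof -
  obtain \<tau> \<rho> where S: "{v. x v \<noteq> 0} = Inl ` Sigma {..<d+1} \<tau> \<union> Inr ` \<rho>"
    "\<And>i. i < d+1 \<Longrightarrow> \<tau> i \<in> chessboard r (r+1)" "\<rho> \<in> discrete_complex (r+1)"
    by (rule domain_support) (rule that)
  let ?P = "{..<r+1} \<times> ext_vertices d r" and ?s = "\<lambda>(j, w). slot w j"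
  have sub: "{v. x v \<noteq> 0} \<subseteq> ?s ` ?P"
  proof
    fix v assume "v \<in> {v. x v \<noteq> 0}"
    then consider i a j where "v = Inl (i, a, j)" "i < d+1" "(a, j) \<in> \<tau> i"
      | j where "v = Inr j" "j \<in> \<rho>"
      unfolding S(1) by auto
    then show "v \<in> ?s ` ?P"
    proof cases
      case 1
      then have "a < r" "j < r+1" using S(2)[of i] by (auto simp: chessboard_def)
      with 1 show ?thesis
        by (intro image_eqI[of _ _ "(j, Some (i, a))"]) (auto simp: slot_def ext_vertices_def)
    next
      case 2
      then have "j < r+1" using S(3) by (auto simp: discrete_complex_def)
      with 2 show ?thesis
        by (intro image_eqI[of _ _ "(j, None)"]) (auto simp: slot_def ext_vertices_def)
    qed
  qed
  have "1 = sum x {v. x v \<noteq> 0}" using x by (simp add: realization_def)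
  also have "\<dots> = sum x (?s ` ?P)"
    using sub by (intro sum.mono_neutral_left) auto
  also have "\<dots> = (\<Sum>(j, w)\<in>?P. x (slot w j))"
    by (subst sum.reindex) (auto simp: inj_on_def intro!: sum.cong)
  also have "\<dots> = (\<Sum>j<r+1. face_mass d r x j)"
    by (simp add: face_mass_def sum.cartesian_product)
  finally show ?thesis by simp
qed

lemma face_mass_nonneg: "0 \<le> face_mass d r x j"
  unfolding face_mass_def by (intro sum_nonneg domain_realization_nonneg)

end

section \<open>The equivariant test map and its zeros\<close>

text \<open>The vertex \<open>None\<close> of the extended simplex is sent to the existing vertex \<open>c 0 0\<close>; this
  extends \<open>f\<close> continuously. The function \<open>arctan\<close> makes the values bounded without changing
  coincidences, which keeps \<open>test_map\<close> continuous where a face has mass 0.\<close>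

locale configuration =
  fixes d r n :: nat and c :: "nat \<Rightarrow> nat \<Rightarrow> nat" and f :: "(nat \<Rightarrow> real) \<Rightarrow> (nat \<Rightarrow> real)"
  assumes r_pos: "r > 0"
    and c_less: "\<And>i a. i < d+1 \<Longrightarrow> a < r \<Longrightarrow> c i a < n"
    and continuous_f: "continuous_map (realization_top (Pow {..<n})) (Euclidean_space d) f"
begin

definition vertex :: "(nat \<times> nat) option \<Rightarrow> nat" where
  "vertex w = (case w of None \<Rightarrow> c 0 0 | Some (i, a) \<Rightarrow> c i a)"

definition point :: "((nat \<times> nat \<times> nat) + nat \<Rightarrow> real) \<Rightarrow> nat \<Rightarrow> nat \<Rightarrow> real" where
  "point x j v = (\<Sum>w | w \<in> ext_vertices d r \<and> vertex w = v. x (slot w j)) / face_mass d r x j"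

definition test_map :: "((nat \<times> nat \<times> nat) + nat \<Rightarrow> real) \<Rightarrow> nat \<Rightarrow> nat \<Rightarrow> real" where
  "test_map x i j = face_mass d r x j * (if i < d then arctan (f (point x j) i) else 1)"

text \<open>Subtracting the average projects each row orthogonally onto \<open>W_rep (r+1)\<close>.
  The value 0 for other indices is forced by \<open>W_rep_power\<close>.\<close>

definition centered_map :: "((nat \<times> nat \<times> nat) + nat \<Rightarrow> real) \<Rightarrow> nat \<times> nat \<Rightarrow> real" where
  "centered_map x = (\<lambda>(i, j). if i < d+1 \<and> j < r+1
     then test_map x i j - (\<Sum>k<r+1. test_map x i k) / (r+1) else 0)"

definition square_norm :: "((nat \<times> nat \<times> nat) + nat \<Rightarrow> real) \<Rightarrow> real" where
  "square_norm x = (\<Sum>i<d+1. \<Sum>j<r+1. (centered_map x (i, j))\<^sup>2)"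

lemma vertex_less: "w \<in> ext_vertices d r \<Longrightarrow> vertex w < n"
  using c_less r_pos by (auto simp: ext_vertices_def vertex_def)

lemma point_in_realization:
  assumes x: "x \<in> realization (domain_complex d r)" and "face_mass d r x j \<noteq> 0"
  shows "point x j \<in> realization (Pow {..<n})"
proof -
  have "sum (point x j) {..<n} =
      (\<Sum>v<n. \<Sum>w | w \<in> ext_vertices d r \<and> vertex w = v. x (slot w j)) / face_mass d r x j"
    by (simp add: point_def sum_divide_distrib)
  also have "(\<Sum>v<n. \<Sum>w | w \<in> ext_vertices d r \<and> vertex w = v. x (slot w j)) = face_mass d r x j"
    unfolding face_mass_def using vertex_less by (intro sum.group) auto
  finally have "sum (point x j) {..<n} = 1" using assms by simp
  moreover have "point x j v = 0" if "v \<notin> {..<n}" for v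
  proof -
    have "{w. w \<in> ext_vertices d r \<and> vertex w = v} = {}" using that vertex_less by auto
    then show ?thesis unfolding point_def by (simp only: sum.empty div_0)
  qed
  moreover have "0 \<le> point x j v" for v
    unfolding point_def
    by (intro divide_nonneg_nonneg sum_nonneg face_mass_nonneg[OF x] domain_realization_nonneg[OF x])
  ultimately show ?thesis by (simp add: realization_Pow_iff)
qed

text \<open>Links the test map to the faces: the point evaluated for index \<open>j\<close> lies in
  the face spanned by the vertices that carry weight there.\<close>

lemma point_in_face:
  assumes "x \<in> realization (domain_complex d r)" and "face_mass d r x j \<noteq> 0"
  shows "point x j \<in> realization (Pow (vertex ` {w \<in> ext_vertices d r. x (slot w j) \<noteq> 0}))"
proof -
  have "v \<in> vertex ` {w \<in> ext_vertices d r. x (slot w j) \<noteq> 0}" if "point x j v \<noteq> 0" for v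
  proof -
    have "(\<Sum>w | w \<in> ext_vertices d r \<and> vertex w = v. x (slot w j)) \<noteq> 0"
      using that by (auto simp: point_def)
    then obtain w where "w \<in> ext_vertices d r" "vertex w = v" "x (slot w j) \<noteq> 0"
      by (metis (mono_tags, lifting) mem_Collect_eq sum.neutral)
    then show ?thesis by blast
  qed
  then show ?thesis
    using point_in_realization[OF assms] by (auto simp: realization_def)
qed

lemma continuous_on_face_mass: "continuous_on S (\<lambda>x. face_mass d r x j)"
  unfolding face_mass_def by (intro continuous_intros)

lemma continuous_on_test_map:
  "continuous_on (realization (domain_complex d r)) (\<lambda>x. test_map x i j)"
proof (cases "i < d")
  case True
  let ?S = "{x \<in> realization (domain_complex d r). face_mass d r x j \<noteq> 0}"
  have point: "continuous_on ?S (\<lambda>x. point x j)"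
  proof (rule continuous_on_coordinatewise_then_product)
    show "continuous_on ?S (\<lambda>x. point x j v)" for v
      unfolding point_def
      by (rule continuous_on_divide)
        (auto intro!: continuous_on_face_mass continuous_on_sum continuous_on_coordinate)
  qed
  have "continuous_on (realization (Pow {..<n})) (\<lambda>y. f y i)"
    using continuous_f by (simp add: continuous_map_realization_Euclidean_iff)
  moreover have "(\<lambda>x. point x j) ` ?S \<subseteq> realization (Pow {..<n})"
    using point_in_realization by blast
  ultimately have "continuous_on ?S (\<lambda>x. f (point x j) i)"
    by (rule continuous_on_compose2[OF _ point])
  then have "continuous_on ?S (\<lambda>x. arctan (f (point x j) i))"
    by (rule continuous_on_arctan)
  moreover have "\<bar>arctan t\<bar> \<le> pi / 2" for t
    using arctan_bounded[of t] by linarith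
  ultimately have "continuous_on (realization (domain_complex d r))
      (\<lambda>x. face_mass d r x j * arctan (f (point x j) i))"
    by (intro continuous_on_mult_bounded[of _ _ _ "pi / 2"] continuous_on_face_mass)
  then show ?thesis using True by (simp add: test_map_def)
next
  case False
  then show ?thesis by (simp add: test_map_def continuous_on_face_mass)
qed

lemma continuous_on_centered_map:
  "continuous_on (realization (domain_complex d r)) (\<lambda>x. centered_map x p)"
proof (cases p)
  case (Pair i j)
  show ?thesis
    unfolding centered_map_def Pair
    by (cases "i < d+1 \<and> j < r+1")
      (auto intro!: continuous_on_diff continuous_on_divide continuous_on_sum
        continuous_on_add continuous_on_test_map continuous_on_const)
qed

lemma continuous_on_square_norm:
  "continuous_on (realization (domain_complex d r)) square_norm"
  unfolding square_norm_def
  by (intro continuous_on_sum continuous_on_power continuous_on_centered_map)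

lemma sum_centered_map: "i < d+1 \<Longrightarrow> (\<Sum>j<r+1. centered_map x (i, j)) = 0"
  by (simp add: centered_map_def sum_subtractf del: sum.lessThan_Suc)

text \<open>Face \<open>\<pi> j\<close> of the permuted point is face \<open>j\<close> of the
  original, with the same mass and the same normalized point.\<close>

lemma test_map_perm:
  assumes "inj \<pi>"
  shows "test_map (perm_action (domain_vertex_map \<pi>) x) i (\<pi> j) = test_map x i j"
proof -
  have m: "face_mass d r (perm_action (domain_vertex_map \<pi>) x) (\<pi> j) = face_mass d r x j"
    by (simp add: face_mass_def perm_action_slot[OF assms])
  moreover have "point (perm_action (domain_vertex_map \<pi>) x) (\<pi> j) = point x j"
    by (simp add: fun_eq_iff point_def m perm_action_slot[OF assms])
  ultimately show ?thesis by (simp add: test_map_def)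
qed

lemma centered_map_perm:
  assumes "\<pi> permutes {..<r+1}"
  shows "centered_map (perm_action (domain_vertex_map \<pi>) x) (i, \<pi> j) = centered_map x (i, j)"
proof -
  have "inj \<pi>" using assms by (rule permutes_inj)
  note t = test_map_perm[OF this, of x]
  have "(\<Sum>k<r+1. test_map (perm_action (domain_vertex_map \<pi>) x) i k) = (\<Sum>k<r+1. test_map x i k)"
    using sum.permute[OF assms, of "test_map (perm_action (domain_vertex_map \<pi>) x) i"]
    by (simp add: t o_def del: sum.lessThan_Suc)
  moreover have "\<pi> j < r+1 \<longleftrightarrow> j < r+1"
    using permutes_in_image[OF assms, of j] by simp
  ultimately show ?thesis by (simp add: centered_map_def t del: sum.lessThan_Suc)
qed

lemma square_norm_perm:
  assumes "\<pi> permutes {..<r+1}"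
  shows "square_norm (perm_action (domain_vertex_map \<pi>) x) = square_norm x"
  unfolding square_norm_def
proof (rule sum.cong[OF refl])
  fix i
  show "(\<Sum>j<r+1. (centered_map (perm_action (domain_vertex_map \<pi>) x) (i, j))\<^sup>2)
      = (\<Sum>j<r+1. (centered_map x (i, j))\<^sup>2)"
    using sum.permute[OF assms, of "\<lambda>j. (centered_map (perm_action (domain_vertex_map \<pi>) x) (i, j))\<^sup>2"]
    by (simp add: centered_map_perm[OF assms] o_def del: sum.lessThan_Suc)
qed

text \<open>Dividing by the norm moves a nowhere vanishing \<open>centered_map\<close> to the unit
  sphere, and keeps it equivariant since \<open>square_norm\<close> is invariant. In contrapositive
  form this produces a zero.\<close>

lemma equivariant_map_if_nonzero:
  assumes nz: "\<And>x. x \<in> realization (domain_complex d r) \<Longrightarrow> square_norm x \<noteq> 0"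
  shows "\<exists>F. continuous_map (realization_top (domain_complex d r)) (W_sphere_top (r+1) (d+1)) F \<and>
    equivariant_map d r F"
proof (intro exI conjI)
  let ?F = "\<lambda>x p. centered_map x p / sqrt (square_norm x)"
  have nonneg: "square_norm x \<ge> 0" for x
    unfolding square_norm_def by (intro sum_nonneg zero_le_power2)
  show "equivariant_map d r ?F"
    unfolding equivariant_map_def
  proof (intro allI impI ballI ext)
    fix \<pi> x and p :: "nat \<times> nat" assume \<pi>: "\<pi> permutes {..<r+1}"
    \<comment> \<open>\<open>perm_action\<close> is easiest to evaluate at a permuted index, and
      every index is one because \<open>\<pi>\<close> is surjective.\<close>
    obtain i j where p: "p = map_prod id \<pi> (i, j)"
      using permutes_surj[OF \<pi>] by (metis id_apply map_prod_simp surjE surj_pair)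
    have "inj (map_prod id \<pi> :: nat \<times> nat \<Rightarrow> _)"
      using permutes_inj[OF \<pi>] by (intro prod.inj_map) auto
    then show "?F (perm_action (domain_vertex_map \<pi>) x) p = perm_action (map_prod id \<pi>) (?F x) p"
      unfolding p by (subst perm_action_apply)
        (simp_all add: centered_map_perm[OF \<pi>] square_norm_perm[OF \<pi>])
  qed
  show "continuous_map (realization_top (domain_complex d r)) (W_sphere_top (r+1) (d+1)) ?F"
    unfolding W_sphere_top_def continuous_map_realization_iff
  proof (intro conjI allI image_subsetI CollectI)
    fix p
    show "continuous_on (realization (domain_complex d r)) (\<lambda>x. ?F x p)"
      using nz by (intro continuous_on_divide continuous_on_centered_map continuous_on_real_sqrt
          continuous_on_square_norm) auto
  next
    fix x assume x: "x \<in> realization (domain_complex d r)"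
    have "(\<Sum>j<r+1. ?F x (i, j)) = 0" if "i < d+1" for i
      using sum_centered_map[OF that, of x]
      by (simp only: sum_divide_distrib[symmetric] div_0)
    then show "?F x \<in> W_rep_power (r+1) (d+1)"
      by (auto simp: W_rep_power_def W_rep_def topspace_Euclidean_space centered_map_def
          simp del: sum.lessThan_Suc)
    show "(\<Sum>i<d+1. \<Sum>j<r+1. (?F x (i, j))\<^sup>2) = 1"
      using nz[OF x]
      by (simp only: power_divide sum_divide_distrib[symmetric] real_sqrt_pow2[OF nonneg]
          square_norm_def[symmetric]) simp
  qed
qed

text \<open>At a zero every row of \<open>test_map\<close> is constant. Row \<open>d\<close>
  consists of the masses, which are thus equal and, having sum 1, nonzero; dividing the other rows
  by them and using injectivity of \<open>arctan\<close> gives equal images.\<close>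

lemma square_norm_zeroD:
  assumes x: "x \<in> realization (domain_complex d r)" and "square_norm x = 0" and j: "j < r+1"
  shows "face_mass d r x j \<noteq> 0" and "f (point x j) = f (point x 0)"
proof -
  have c: "centered_map x (i, j) = 0" if "i < d+1" "j < r+1" for i j
  proof -
    have "(\<Sum>j<r+1. (centered_map x (i, j))\<^sup>2) = 0"
      using assms(2) that(1) unfolding square_norm_def
      by (subst (asm) sum_nonneg_eq_0_iff) (auto intro: sum_nonneg simp del: sum.lessThan_Suc)
    then show ?thesis
      using that(2) by (subst (asm) sum_nonneg_eq_0_iff) auto
  qed
  have "test_map x i j = (\<Sum>k<r+1. test_map x i k) / (r+1)" if "i < d+1" "j < r+1" for i j
    using c[OF that] that by (simp only: centered_map_def) simp
  then have t: "test_map x i j = test_map x i 0" if "i < d+1" "j < r+1" for i j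
    using that by (metis add_gr_0 zero_less_one)
  have m: "face_mass d r x j = face_mass d r x 0" if "j < r+1" for j
    using t[of d j] that by (simp add: test_map_def)
  have m0: "face_mass d r x 0 \<noteq> 0"
  proof
    assume "face_mass d r x 0 = 0"
    then have "face_mass d r x j = 0" if "j < r+1" for j using m[OF that] by simp
    then have "(\<Sum>j<r+1. face_mass d r x j) = 0" by (intro sum.neutral) blast
    then show False using sum_face_mass[OF x] by simp
  qed
  then show mj: "face_mass d r x j \<noteq> 0" using m[OF j] by simp
  show "f (point x j) = f (point x 0)"
  proof
    fix i
    show "f (point x j) i = f (point x 0) i"
    proof (cases "i < d")
      case True
      then show ?thesis using t[of i j] j m[OF j] m0 by (simp add: test_map_def arctan_eq_iff)
    next
      case False
      then show ?thesis
        using continuous_f point_in_realization[OF x mj] point_in_realization[OF x m0]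
        by (simp add: continuous_map_realization_Euclidean_iff)
    qed
  qed
qed

end

section \<open>From a zero of the test map to disjoint rainbow faces\<close>

lemma ex_inj_avoiding:
  obtains s where "inj_on s {..<r}" "\<And>k. k < r \<Longrightarrow> s k < r+1 \<and> s k \<noteq> (j0::nat)"
proof
  let ?s = "\<lambda>k. if k < j0 then k else k + 1"
  show "inj_on ?s {..<r}" by (auto simp: inj_on_def)
  show "\<And>k. k < r \<Longrightarrow> ?s k < r+1 \<and> ?s k \<noteq> j0" by auto
qed

text \<open>Stated for every continuous map and every number of vertices, so that it yields both
  upper bounds.\<close>

proposition rainbow_intersection_if_no_equivariant_map:
  assumes r: "r > 0"
    and no_map: "\<not> (\<exists>F. continuous_map (realization_top (domain_complex d r)) (W_sphere_top (r+1) (d+1)) F \<and>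
                equivariant_map d r F)"
    and f: "continuous_map (realization_top (Pow {..<n})) (Euclidean_space d) f"
    and C: "coloring (d+1) {..<n} C" and card: "\<And>i. i < d+1 \<Longrightarrow> r \<le> card (C i)"
  shows "has_rainbow_intersection n (d+1) r C f"
proof -
  have "\<exists>g. inj_on g {..<r} \<and> g ` {..<r} \<subseteq> C i" if i: "i < d+1" for i
  proof -
    obtain T where "T \<subseteq> C i" "card T = r" "finite T"
      using card[OF i] by (meson obtain_subset_with_card_n)
    then show ?thesis
      using ex_bij_betw_nat_finite[of T] by (auto simp: bij_betw_def atLeast0LessThan)
  qed
  then obtain c where inj: "\<And>i. i < d+1 \<Longrightarrow> inj_on (c i) {..<r}"
    and cC: "\<And>i. i < d+1 \<Longrightarrow> c i ` {..<r} \<subseteq> C i" by metis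
  have cin: "c i a \<in> C i" if "i < d+1" "a < r" for i a using cC that by blast
  have Cn: "(\<Union>i<d+1. C i) = {..<n}" and disj: "disjoint_family_on C {..<d+1}"
    using C by (auto simp: coloring_def)
  have color_eq: "i = k" if "v \<in> C i" "v \<in> C k" "i < d+1" "k < d+1" for v i k
    using disjoint_family_onD[OF disj, of i k] that by auto
  interpret configuration d r n c f
  proof
    show "c i a < n" if "i < d+1" "a < r" for i a
      using cin[OF that] Cn that by blast
  qed (use r f in auto)
  obtain x where x: "x \<in> realization (domain_complex d r)" and "square_norm x = 0"
    using equivariant_map_if_nonzero no_map by blast
  note zero = square_norm_zeroD[OF this]
  define face where "face = (\<lambda>j. vertex ` {w \<in> ext_vertices d r. x (slot w j) \<noteq> 0})"
  \<comment> \<open>\<open>j0\<close> is the face containing the extra vertex; if there is none, any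
    index will do, even one above \<open>r\<close>.\<close>
  obtain j0 where j0: "\<And>j. j \<noteq> j0 \<Longrightarrow> x (slot None j) = 0"
    using domain_slot_unique[OF x, of None] by metis
  \<comment> \<open>The vertex \<open>c 0 0\<close> also represents \<open>None\<close>. Away from
    \<open>j0\<close> this second role carries no weight, so each vertex of the face comes from a
    chosen colored vertex.\<close>
  have faceE: "\<exists>i a. i < d+1 \<and> a < r \<and> v = c i a \<and> x (slot (Some (i, a)) j) \<noteq> 0"
    if "v \<in> face j" "j \<noteq> j0" for v j
    using that j0[OF that(2)] by (fastforce simp: face_def ext_vertices_def vertex_def)
  obtain s where s: "inj_on s {..<r}" "\<And>k. k < r \<Longrightarrow> s k < r+1 \<and> s k \<noteq> j0"
    using ex_inj_avoiding[of r j0] by blast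
  have sub: "face j \<subseteq> {..<n}" for j using vertex_less by (auto simp: face_def)
  \<comment> \<open>A common vertex has one color and, as \<open>c i\<close> is injective, one
    position \<open>a\<close> within it; the same slot vertex cannot be used by two faces.\<close>
  have disjoint: "j = k" if v: "v \<in> face j" "v \<in> face k" "j \<noteq> j0" "k \<noteq> j0" for v j k
  proof -
    obtain i a where 1: "i < d+1" "a < r" "v = c i a" "x (slot (Some (i, a)) j) \<noteq> 0"
      using faceE v by blast
    obtain i' a' where 2: "i' < d+1" "a' < r" "v = c i' a'" "x (slot (Some (i', a')) k) \<noteq> 0"
      using faceE v by blast
    have "v \<in> C i" "v \<in> C i'" using cin[OF 1(1,2)] cin[OF 2(1,2)] 1(3) 2(3) by simp_all
    then have "i = i'" using color_eq 1(1) 2(1) by blast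
    moreover from this have "a = a'" using inj_onD[OF inj[OF 1(1)], of a a'] 1 2 by auto
    ultimately show ?thesis using domain_slot_unique[OF x] 1(4) 2(4) by blast
  qed
  have rainbow: "rainbow (d+1) C (face j)" if "j \<noteq> j0" for j
    unfolding rainbow_def
  proof (intro allI impI)
    fix i assume i: "i < d+1"
    have *: "\<exists>a. v = c i a \<and> x (slot (Some (i, a)) j) \<noteq> 0" if v: "v \<in> face j \<inter> C i" for v
    proof -
      obtain k a where 1: "k < d+1" "a < r" "v = c k a" "x (slot (Some (k, a)) j) \<noteq> 0"
        using faceE v \<open>j \<noteq> j0\<close> by blast
      then have "k = i" using color_eq[of v k i] cin[of k a] v i by auto
      then show ?thesis using 1 by blast
    qed
    have "v = w" if "v \<in> face j \<inter> C i" "w \<in> face j \<inter> C i" for v w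
      using *[OF that(1)] *[OF that(2)] domain_slot_rainbow[OF x] by blast
    then show "card (face j \<inter> C i) \<le> 1"
      using sub[of j] by (subst card_le_Suc0_iff_eq[folded One_nat_def]) (auto intro: finite_subset)
  qed
  have "f (point x 0) \<in> f ` realization (Pow (face (s k)))" if "k < r" for k
  proof -
    have j: "s k < r+1" using s(2)[OF that] by simp
    show ?thesis
      using imageI[OF point_in_face[OF x zero(1)[OF j]], of f]
      unfolding zero(2)[OF j] face_def .
  qed
  then have "(\<Inter>k<r. f ` realization (Pow (face (s k)))) \<noteq> {}" by blast
  moreover have "disjoint_family_on (\<lambda>k. face (s k)) {..<r}"
    unfolding disjoint_family_on_def
  proof (intro ballI impI)
    fix k l assume kl: "k \<in> {..<r}" "l \<in> {..<r}" "k \<noteq> l"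
    then have "s k \<noteq> s l" using inj_onD[OF s(1)] by blast
    then show "face (s k) \<inter> face (s l) = {}"
      using disjoint[of _ "s k" "s l"] s(2) kl by blast
  qed
  moreover have "\<forall>k<r. face (s k) \<subseteq> {..<n} \<and> rainbow (d+1) C (face (s k))"
    using sub rainbow s(2) by blast
  ultimately show ?thesis
    unfolding has_rainbow_intersection_def by (intro exI[of _ "\<lambda>k. face (s k)"] conjI)
qed

section \<open>The exact values of the two numbers\<close>

lemma Inf_enat_image_eqI:
  assumes "m \<in> A" and "\<And>k. k \<in> A \<Longrightarrow> m \<le> k"
  shows "Inf (enat ` A) = enat m"
  using assms by (intro antisym Inf_lower Inf_greatest) auto

theorem theorem6p3:
  fixes r d :: nat
  assumes "r \<ge> 2" and "d \<ge> 1"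
    and "\<not> (\<exists>F. continuous_map (realization_top (domain_complex d r)) (W_sphere_top (r+1) (d+1)) F \<and>
                equivariant_map d r F)"
  shows "n_number d r = enat ((d+1) * r) \<and> tt_number d r = enat r"
proof
  have r: "r > 0" using assms(1) by simp
  note rainbow = rainbow_intersection_if_no_equivariant_map[OF r assms(3)]
  show "n_number d r = enat ((d+1) * r)"
    unfolding n_number_def
  proof (rule Inf_enat_image_eqI, intro CollectI conjI)
    show "\<exists>C. coloring (d+1) {..<(d+1) * r} C \<and> (\<forall>i<d+1. r \<le> card (C i))"
      using coloring_blocks[OF r, of "d+1"] by (intro exI conjI) auto
    show "\<forall>f C. affine_simplex_map ((d+1) * r) d f \<and> coloring (d+1) {..<(d+1) * r} C \<and>
        (\<forall>i<d+1. r \<le> card (C i)) \<longrightarrow> has_rainbow_intersection ((d+1) * r) (d+1) r C f"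
      using rainbow affine_simplex_map_continuous by blast
  next
    fix n assume "n \<in> {n. (\<exists>C. coloring (d+1) {..<n} C \<and> (\<forall>i<d+1. r \<le> card (C i))) \<and>
      (\<forall>f C. affine_simplex_map n d f \<and> coloring (d+1) {..<n} C \<and> (\<forall>i<d+1. r \<le> card (C i))
        \<longrightarrow> has_rainbow_intersection n (d+1) r C f)}"
    then obtain C where "coloring (d+1) {..<n} C" "\<forall>i<d+1. r \<le> card (C i)" by blast
    then show "(d+1) * r \<le> n" by (rule coloring_card_le)
  qed
  show "tt_number d r = enat r"
    unfolding tt_number_def
  proof (rule Inf_enat_image_eqI)
    show "r \<in> {t. \<forall>n\<ge>1. \<forall>f C. continuous_map (realization_top (Pow {..<n})) (Euclidean_space d) f \<and>
        coloring (d+1) {..<n} C \<and> (\<forall>i<d+1. t \<le> card (C i))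
        \<longrightarrow> has_rainbow_intersection n (d+1) r C f}"
      using rainbow by blast
  next
    fix t assume "t \<in> {t. \<forall>n\<ge>1. \<forall>f C. continuous_map (realization_top (Pow {..<n})) (Euclidean_space d) f \<and>
        coloring (d+1) {..<n} C \<and> (\<forall>i<d+1. t \<le> card (C i))
        \<longrightarrow> has_rainbow_intersection n (d+1) r C f}"
    then have t: "has_rainbow_intersection n (d+1) r C f"
      if "n \<ge> 1" "continuous_map (realization_top (Pow {..<n})) (Euclidean_space d) f"
        "coloring (d+1) {..<n} C" "\<forall>i<d+1. t \<le> card (C i)" for n f C
      using that by blast
    show "r \<le> t"
    proof (rule ccontr)
      assume "\<not> r \<le> t"
      \<comment> \<open>The largest class size below \<open>r\<close>. It is positive because
        \<open>r\<close> is at least 2, so the simplex of the counterexample is nonempty.\<close>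
      define m where "m = r - 1"
      have m: "m > 0" "m < r" "t \<le> m"
        using assms(1) \<open>\<not> r \<le> t\<close> by (auto simp: m_def)
      obtain f where f: "continuous_map (realization_top (Pow {..<(d+1) * m})) (Euclidean_space d) f"
        "\<not> has_rainbow_intersection ((d+1) * m) (d+1) r (\<lambda>i. {i * m..<i * m + m}) f"
        using no_rainbow_intersection[OF m(1,2), of d] by blast
      have "has_rainbow_intersection ((d+1) * m) (d+1) r (\<lambda>i. {i * m..<i * m + m}) f"
        by (rule t[OF _ f(1) coloring_blocks[OF m(1)]]) (use m in auto)
      with f(2) show False by contradiction
    qed
  qed
qed

end
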